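(* Let $R$ be a commutative, associative, unital ring and let $N$ be a $\text{Red}$-quasi-injective $R$-module. Then: (1) ($\text{Red}$-C2) If $P$ and $Q$ are semi-reduced submodules of $N$, $P\cong Q$ and $P$ is a direct summand of $N$, then $Q$ is a direct summand of $N$. (2) ($\text{Red}$-C3) Let $P$ and $Q$ be semi-reduced submodules of $N$ with $P\cap Q=\{0\}$. If $P$ and $Q$ are both direct summands of $N$, then $P\oplus Q$ is a direct summand of $N$.
   Context: All modules are unital right $R$-modules. An $R$-module $M$ is reduced if for all $r\in R$ and $m\in M$, $mr^{2}=0$ implies $mr=0$; a submodule is reduced if it is reduced as a module. $\text{Red}(M)$ denotes the sum of all reduced submodules of $M$. A module $M$ is semi-reduced if $\text{Red}(M)=M$; a submodule is semi-reduced if it is so as a module. For $R$-modules $M$ and $N$, $M$ is $\text{Red}$-$N$-injective if for every semi-reduced submodule $K$ of $N$, every $R$-homomorphism $f:K\rightarrow M$ extends to an $R$-homomorphism $N\rightarrow M$. $M$ is $\text{Red}$-quasi-injective if it is $\text{Red}$-$M$-injective. *)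

theory Defs
  imports "HOL-Algebra.Module" "HOL-Algebra.AbelCoset"
begin

(* The ring is commutative, so the right action m r is written r \<odot> m.
   A submodule K of M, regarded as a module, is M\<lparr>carrier := K\<rparr>. *)

definition mod_hom ::
  "('a, 'r) ring_scheme \<Rightarrow> ('a, 'b, 'm) module_scheme \<Rightarrow> ('a, 'c, 'n) module_scheme \<Rightarrow> ('b \<Rightarrow> 'c) set"
  where "mod_hom R M N =
    {f \<in> hom (add_monoid M) (add_monoid N).
       \<forall>r\<in>carrier R. \<forall>x\<in>carrier M. f (r \<odot>\<^bsub>M\<^esub> x) = r \<odot>\<^bsub>N\<^esub> f x}"

definition mod_isomorphic ::
  "('a, 'r) ring_scheme \<Rightarrow> ('a, 'b, 'm) module_scheme \<Rightarrow> ('a, 'c, 'n) module_scheme \<Rightarrow> bool"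
  where "mod_isomorphic R M N \<longleftrightarrow>
    (\<exists>f\<in>mod_hom R M N. bij_betw f (carrier M) (carrier N))"

definition direct_summand ::
  "('a, 'r) ring_scheme \<Rightarrow> ('a, 'b, 'm) module_scheme \<Rightarrow> 'b set \<Rightarrow> bool"
  where "direct_summand R M P \<longleftrightarrow>
    submodule P R M \<and>
    (\<exists>P'. submodule P' R M \<and> P \<inter> P' = {\<zero>\<^bsub>M\<^esub>} \<and> P <+>\<^bsub>M\<^esub> P' = carrier M)"

definition reduced_module ::
  "('a, 'r) ring_scheme \<Rightarrow> ('a, 'b, 'm) module_scheme \<Rightarrow> bool"
  where "reduced_module R M \<longleftrightarrow>
    (\<forall>r\<in>carrier R. \<forall>m\<in>carrier M.
       (r [^]\<^bsub>R\<^esub> (2::nat)) \<odot>\<^bsub>M\<^esub> m = \<zero>\<^bsub>M\<^esub> \<longrightarrow> r \<odot>\<^bsub>M\<^esub> m = \<zero>\<^bsub>M\<^esub>)"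

definition reduced_submodule ::
  "('a, 'r) ring_scheme \<Rightarrow> ('a, 'b, 'm) module_scheme \<Rightarrow> 'b set \<Rightarrow> bool"
  where "reduced_submodule R M K \<longleftrightarrow>
    submodule K R M \<and> reduced_module R (M\<lparr>carrier := K\<rparr>)"

(* The sum of an arbitrary family of submodules: all finite sums of elements
   taken from members of the family. *)
definition submodule_sum :: "('a, 'b, 'm) module_scheme \<Rightarrow> 'b set set \<Rightarrow> 'b set"
  where "submodule_sum M \<K> =
    {\<Oplus>\<^bsub>M\<^esub>K\<in>F. f K | F f. finite F \<and> F \<subseteq> \<K> \<and> (\<forall>K\<in>F. f K \<in> K)}"

definition Red :: "('a, 'r) ring_scheme \<Rightarrow> ('a, 'b, 'm) module_scheme \<Rightarrow> 'b set"
  where "Red R M = submodule_sum M {K. reduced_submodule R M K}"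

definition semi_reduced_module ::
  "('a, 'r) ring_scheme \<Rightarrow> ('a, 'b, 'm) module_scheme \<Rightarrow> bool"
  where "semi_reduced_module R M \<longleftrightarrow> Red R M = carrier M"

definition semi_reduced_submodule ::
  "('a, 'r) ring_scheme \<Rightarrow> ('a, 'b, 'm) module_scheme \<Rightarrow> 'b set \<Rightarrow> bool"
  where "semi_reduced_submodule R M K \<longleftrightarrow>
    submodule K R M \<and> semi_reduced_module R (M\<lparr>carrier := K\<rparr>)"

(* Red_injective R N M: the module M is Red-N-injective. *)
definition Red_injective ::
  "('a, 'r) ring_scheme \<Rightarrow> ('a, 'b, 'm) module_scheme \<Rightarrow> ('a, 'c, 'n) module_scheme \<Rightarrow> bool"
  where "Red_injective R N M \<longleftrightarrow>
    (\<forall>K f. semi_reduced_submodule R N K \<longrightarrow> f \<in> mod_hom R (N\<lparr>carrier := K\<rparr>) M \<longrightarrow>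
       (\<exists>g\<in>mod_hom R N M. \<forall>x\<in>K. g x = f x))"

definition Red_quasi_injective ::
  "('a, 'r) ring_scheme \<Rightarrow> ('a, 'b, 'm) module_scheme \<Rightarrow> bool"
  where "Red_quasi_injective R M \<longleftrightarrow> Red_injective R M M"

end

(* Direct summands are exactly the images of idempotent endomorphisms, so it suffices to
   construct retractions.
   (1) Extend the inverse of an isomorphism f : P -> Q to N and follow the extension by a
   projection onto P and by f.
   (2) Since P + Q is again semi-reduced, the two projections of P + Q = P \<oplus> Q extend to N;
   following them by projections of N onto P and onto Q and adding the results gives a
   retraction of N onto P + Q. *)

theory Submission
  imports Defs
begin

section \<open>Homomorphisms and submodules\<close>

lemma mod_homI:
  assumes "\<And>x. x \<in> carrier M \<Longrightarrow> f x \<in> carrier N"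
    and "\<And>x y. x \<in> carrier M \<Longrightarrow> y \<in> carrier M \<Longrightarrow> f (x \<oplus>\<^bsub>M\<^esub> y) = f x \<oplus>\<^bsub>N\<^esub> f y"
    and "\<And>r x. r \<in> carrier R \<Longrightarrow> x \<in> carrier M \<Longrightarrow> f (r \<odot>\<^bsub>M\<^esub> x) = r \<odot>\<^bsub>N\<^esub> f x"
  shows "f \<in> mod_hom R M N"
  using assms by (auto simp: mod_hom_def hom_def)

lemma mod_homD:
  assumes "f \<in> mod_hom R M N"
  shows "\<And>x. x \<in> carrier M \<Longrightarrow> f x \<in> carrier N"
    and "\<And>x y. x \<in> carrier M \<Longrightarrow> y \<in> carrier M \<Longrightarrow> f (x \<oplus>\<^bsub>M\<^esub> y) = f x \<oplus>\<^bsub>N\<^esub> f y"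
    and "\<And>r x. r \<in> carrier R \<Longrightarrow> x \<in> carrier M \<Longrightarrow> f (r \<odot>\<^bsub>M\<^esub> x) = r \<odot>\<^bsub>N\<^esub> f x"
  using assms by (auto simp: mod_hom_def hom_def)

lemma (in module) submodule_zero:
  assumes "submodule H R M"
  shows "\<zero>\<^bsub>M\<^esub> \<in> H"
  using subgroup.one_closed[OF submodule.axioms(1)[OF assms]] by simp

text \<open>Replacing the carrier twice gives the same record as replacing it once, so in both
  directions \<open>K\<close> is a module under the same operations. A subset that is a module in
  this way is a submodule of any module containing it.\<close>

lemma (in module) submodule_of_submodule:
  assumes "submodule H R M"
  shows "submodule K R (M\<lparr>carrier := H\<rparr>) \<longleftrightarrow> submodule K R M \<and> K \<subseteq> H"
proof -
  interpret H: module R "M\<lparr>carrier := H\<rparr>"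
    by (rule submodule.submodule_is_module[OF assms module_axioms])
  have H: "H \<subseteq> carrier M" by (rule submoduleE(1)[OF assms])
  show ?thesis
  proof
    assume K: "submodule K R (M\<lparr>carrier := H\<rparr>)"
    have "module R (M\<lparr>carrier := K\<rparr>)"
      using submodule.submodule_is_module[OF K H.module_axioms] by simp
    then show "submodule K R M \<and> K \<subseteq> H"
      using H.submoduleE(1)[OF K] H by (auto intro: module_incl_imp_submodule)
  next
    assume K: "submodule K R M \<and> K \<subseteq> H"
    then have "module R (M\<lparr>carrier := K\<rparr>)"
      using submodule.submodule_is_module[OF _ module_axioms] by blast
    then show "submodule K R (M\<lparr>carrier := H\<rparr>)"
      using K by (intro H.module_incl_imp_submodule) auto
  qed
qed

text \<open>A submodule inherits zero and addition, so induction on \<open>A\<close> identifies the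
  two sums. This is needed because \<open>Red\<close> of a submodule is built from
  \<open>finsum\<close> taken in the restricted record.\<close>

lemma (in module) finsum_submodule:
  assumes "submodule H R M" and "finite A" and "f \<in> A \<rightarrow> H"
  shows "finsum (M\<lparr>carrier := H\<rparr>) f A = finsum M f A"
proof -
  interpret H: module R "M\<lparr>carrier := H\<rparr>"
    by (rule submodule.submodule_is_module[OF assms(1) module_axioms])
  have H: "H \<subseteq> carrier M" by (rule submoduleE(1)[OF assms(1)])
  show ?thesis
    using assms(2,3)
  proof (induction A rule: finite_induct)
    case empty
    then show ?case by simp
  next
    case (insert a A)
    then have "f \<in> A \<rightarrow> carrier M" "f a \<in> carrier M"
      using H by (auto simp: Pi_def)
    with insert show ?case
      by (simp add: Pi_def)
  qed
qed

text \<open>The sum formed inside the module with carrier \<open>H\<close> stays in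
  \<open>H\<close>, and it agrees with the sum formed in \<open>M\<close>.\<close>

lemma (in module) finsum_in_submodule:
  assumes "submodule H R M" and "finite A" and "f \<in> A \<rightarrow> H"
  shows "finsum M f A \<in> H"
proof -
  interpret H: module R "M\<lparr>carrier := H\<rparr>"
    by (rule submodule.submodule_is_module[OF assms(1) module_axioms])
  show ?thesis
    using H.finsum_closed[of f A] assms(3) finsum_submodule[OF assms] by simp
qed

section \<open>Sums of two submodules\<close>

lemma (in module) mem_set_add_iff:
  "x \<in> A <+>\<^bsub>M\<^esub> B \<longleftrightarrow> (\<exists>a\<in>A. \<exists>b\<in>B. x = a \<oplus>\<^bsub>M\<^esub> b)"
  by (auto simp: set_add_def')

lemma (in module) submodule_set_add:
  assumes "submodule A R M" and "submodule B R M"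
  shows "submodule (A <+>\<^bsub>M\<^esub> B) R M"
proof (rule submoduleI)
  note A = submoduleE[OF assms(1)] and B = submoduleE[OF assms(2)]
  show "A <+>\<^bsub>M\<^esub> B \<subseteq> carrier M"
    using A(1) B(1) by (auto simp: mem_set_add_iff subset_iff)
  show "\<zero>\<^bsub>M\<^esub> \<in> A <+>\<^bsub>M\<^esub> B"
    using submodule_zero assms by (force simp: mem_set_add_iff)
  show "\<ominus>\<^bsub>M\<^esub> x \<in> A <+>\<^bsub>M\<^esub> B" if "x \<in> A <+>\<^bsub>M\<^esub> B" for x
  proof -
    from that obtain a b where ab: "a \<in> A" "b \<in> B" "x = a \<oplus>\<^bsub>M\<^esub> b"
      by (auto simp: mem_set_add_iff)
    then have "\<ominus>\<^bsub>M\<^esub> x = \<ominus>\<^bsub>M\<^esub> a \<oplus>\<^bsub>M\<^esub> \<ominus>\<^bsub>M\<^esub> b"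
      using A(1) B(1) by (simp add: subset_iff M.minus_add)
    with ab show ?thesis
      unfolding mem_set_add_iff using A(3) B(3) by blast
  qed
  show "x \<oplus>\<^bsub>M\<^esub> y \<in> A <+>\<^bsub>M\<^esub> B" if "x \<in> A <+>\<^bsub>M\<^esub> B" "y \<in> A <+>\<^bsub>M\<^esub> B" for x y
  proof -
    from that obtain a b c d
      where x: "a \<in> A" "b \<in> B" "x = a \<oplus>\<^bsub>M\<^esub> b" and y: "c \<in> A" "d \<in> B" "y = c \<oplus>\<^bsub>M\<^esub> d"
      by (auto simp: mem_set_add_iff)
    then have "x \<oplus>\<^bsub>M\<^esub> y = (a \<oplus>\<^bsub>M\<^esub> c) \<oplus>\<^bsub>M\<^esub> (b \<oplus>\<^bsub>M\<^esub> d)"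
      using A(1) B(1) by (simp add: subset_iff M.a_ac)
    with x y show ?thesis
      unfolding mem_set_add_iff using A(5) B(5) by blast
  qed
  show "r \<odot>\<^bsub>M\<^esub> x \<in> A <+>\<^bsub>M\<^esub> B" if "r \<in> carrier R" "x \<in> A <+>\<^bsub>M\<^esub> B" for r x
  proof -
    from that obtain a b where ab: "a \<in> A" "b \<in> B" "x = a \<oplus>\<^bsub>M\<^esub> b"
      by (auto simp: mem_set_add_iff)
    then have "r \<odot>\<^bsub>M\<^esub> x = r \<odot>\<^bsub>M\<^esub> a \<oplus>\<^bsub>M\<^esub> r \<odot>\<^bsub>M\<^esub> b"
      using A(1) B(1) that by (simp add: subset_iff smult_r_distr)
    with ab that show ?thesis
      unfolding mem_set_add_iff using A(4) B(4) by blast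
  qed
qed

lemma (in module) subset_set_add:
  assumes "submodule A R M" and "submodule B R M"
  shows "A \<subseteq> A <+>\<^bsub>M\<^esub> B" and "B \<subseteq> A <+>\<^bsub>M\<^esub> B"
proof -
  note sub = submoduleE(1)[OF assms(1)] submoduleE(1)[OF assms(2)]
  show "A \<subseteq> A <+>\<^bsub>M\<^esub> B"
  proof
    fix x assume "x \<in> A"
    with sub have "x = x \<oplus>\<^bsub>M\<^esub> \<zero>\<^bsub>M\<^esub>" by (simp add: subset_iff)
    with \<open>x \<in> A\<close> submodule_zero[OF assms(2)] show "x \<in> A <+>\<^bsub>M\<^esub> B"
      unfolding mem_set_add_iff by blast
  qed
  show "B \<subseteq> A <+>\<^bsub>M\<^esub> B"
  proof
    fix x assume "x \<in> B"
    with sub have "x = \<zero>\<^bsub>M\<^esub> \<oplus>\<^bsub>M\<^esub> x" by (simp add: subset_iff)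
    with \<open>x \<in> B\<close> submodule_zero[OF assms(1)] show "x \<in> A <+>\<^bsub>M\<^esub> B"
      unfolding mem_set_add_iff by blast
  qed
qed

section \<open>Direct sums and retractions\<close>

text \<open>Rearranging the equation gives a - a' = b' - b. The left side is in \<open>A\<close> and
  the right side in \<open>B\<close>, so both lie in the trivial intersection.\<close>

lemma (in module) direct_sum_unique:
  assumes "submodule A R M" and "submodule B R M" and "A \<inter> B = {\<zero>\<^bsub>M\<^esub>}"
    and "a \<in> A" "a' \<in> A" "b \<in> B" "b' \<in> B" and eq: "a \<oplus>\<^bsub>M\<^esub> b = a' \<oplus>\<^bsub>M\<^esub> b'"
  shows "a = a'"
proof -
  note A = submoduleE[OF assms(1)] and B = submoduleE[OF assms(2)]
  have mem: "a \<in> carrier M" "a' \<in> carrier M" "b \<in> carrier M" "b' \<in> carrier M"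
    using assms A(1) B(1) by auto
  have "\<ominus>\<^bsub>M\<^esub> a' \<oplus>\<^bsub>M\<^esub> a = \<ominus>\<^bsub>M\<^esub> a' \<oplus>\<^bsub>M\<^esub> ((a \<oplus>\<^bsub>M\<^esub> b) \<oplus>\<^bsub>M\<^esub> \<ominus>\<^bsub>M\<^esub> b)"
    using mem by (simp add: M.a_assoc M.r_neg)
  also have "\<dots> = (\<ominus>\<^bsub>M\<^esub> a' \<oplus>\<^bsub>M\<^esub> a') \<oplus>\<^bsub>M\<^esub> (b' \<oplus>\<^bsub>M\<^esub> \<ominus>\<^bsub>M\<^esub> b)"
    unfolding eq using mem by (simp add: M.a_assoc)
  also have "\<dots> = b' \<oplus>\<^bsub>M\<^esub> \<ominus>\<^bsub>M\<^esub> b"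
    using mem by (simp add: M.l_neg)
  finally have "\<ominus>\<^bsub>M\<^esub> a' \<oplus>\<^bsub>M\<^esub> a \<in> A \<inter> B"
    using assms(4-7) A(3,5) B(3,5) by (metis IntI)
  then have "\<ominus>\<^bsub>M\<^esub> a' \<oplus>\<^bsub>M\<^esub> a = \<zero>\<^bsub>M\<^esub>"
    using assms(3) by simp
  then have "\<ominus>\<^bsub>M\<^esub> a = \<ominus>\<^bsub>M\<^esub> a'"
    using mem by (intro M.minus_equality) auto
  then show "a = a'"
    using mem by (metis M.minus_minus)
qed

text \<open>Uniqueness of the decomposition makes the \<open>A\<close>-component a well-defined
  linear function of x. The target is \<open>M\<close> and not \<open>A\<close>, because
  Red-injectivity extends maps into the whole module.\<close>

lemma (in module) direct_sum_projection:
  assumes A: "submodule A R M" and B: "submodule B R M" and AB: "A \<inter> B = {\<zero>\<^bsub>M\<^esub>}"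
  obtains p where "p \<in> mod_hom R (M\<lparr>carrier := A <+>\<^bsub>M\<^esub> B\<rparr>) M"
    and "\<And>x. x \<in> A <+>\<^bsub>M\<^esub> B \<Longrightarrow> p x \<in> A"
    and "\<And>a. a \<in> A \<Longrightarrow> p a = a" and "\<And>b. b \<in> B \<Longrightarrow> p b = \<zero>\<^bsub>M\<^esub>"
proof -
  note A' = submoduleE[OF A] and B' = submoduleE[OF B]
  define p where "p x = (THE a. a \<in> A \<and> (\<exists>b\<in>B. x = a \<oplus>\<^bsub>M\<^esub> b))" for x
  \<comment> \<open>Once this evaluation rule is known, the definite description is no longer
    needed: every property of \<open>p\<close> follows by decomposing the arguments and regrouping
    the components.\<close>
  have p: "p (a \<oplus>\<^bsub>M\<^esub> b) = a" if "a \<in> A" "b \<in> B" for a b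
    unfolding p_def using that direct_sum_unique[OF A B AB]
    by (intro the_equality) blast+
  show thesis
  proof
    show "p x \<in> A" if "x \<in> A <+>\<^bsub>M\<^esub> B" for x
      using that p by (auto simp: mem_set_add_iff)
    then have closed: "p x \<in> carrier M" if "x \<in> A <+>\<^bsub>M\<^esub> B" for x
      using that A'(1) by blast
    show "p a = a" if "a \<in> A" for a
      using p[OF that submodule_zero[OF B]] that A'(1) by (simp add: subset_iff)
    show "p b = \<zero>\<^bsub>M\<^esub>" if "b \<in> B" for b
      using p[OF submodule_zero[OF A] that] that B'(1) by (simp add: subset_iff)
    show "p \<in> mod_hom R (M\<lparr>carrier := A <+>\<^bsub>M\<^esub> B\<rparr>) M"
    proof (rule mod_homI; simp)
      show "p x \<in> carrier M" if "x \<in> A <+>\<^bsub>M\<^esub> B" for x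
        using closed that .
    next
      fix x y assume "x \<in> A <+>\<^bsub>M\<^esub> B" "y \<in> A <+>\<^bsub>M\<^esub> B"
      then obtain a b c d
        where x: "a \<in> A" "b \<in> B" "x = a \<oplus>\<^bsub>M\<^esub> b" and y: "c \<in> A" "d \<in> B" "y = c \<oplus>\<^bsub>M\<^esub> d"
        by (auto simp: mem_set_add_iff)
      then have "x \<oplus>\<^bsub>M\<^esub> y = (a \<oplus>\<^bsub>M\<^esub> c) \<oplus>\<^bsub>M\<^esub> (b \<oplus>\<^bsub>M\<^esub> d)"
        using A'(1) B'(1) by (simp add: subset_iff M.a_ac)
      with x y show "p (x \<oplus>\<^bsub>M\<^esub> y) = p x \<oplus>\<^bsub>M\<^esub> p y"
        using A'(5) B'(5) by (simp add: p)
    next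
      fix r x assume r: "r \<in> carrier R" and "x \<in> A <+>\<^bsub>M\<^esub> B"
      then obtain a b where x: "a \<in> A" "b \<in> B" "x = a \<oplus>\<^bsub>M\<^esub> b"
        by (auto simp: mem_set_add_iff)
      then have "r \<odot>\<^bsub>M\<^esub> x = r \<odot>\<^bsub>M\<^esub> a \<oplus>\<^bsub>M\<^esub> r \<odot>\<^bsub>M\<^esub> b"
        using A'(1) B'(1) r by (simp add: subset_iff smult_r_distr)
      with x r show "p (r \<odot>\<^bsub>M\<^esub> x) = r \<odot>\<^bsub>M\<^esub> p x"
        using A'(4) B'(4) by (simp add: p)
    qed
  qed
qed

text \<open>The projection along a complement \<open>P'\<close> serves: as \<open>P\<close> and
  \<open>P'\<close> together span \<open>M\<close>, its domain is the whole carrier.\<close>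

lemma (in module) direct_summand_retraction:
  assumes "direct_summand R M P"
  obtains p where "p \<in> mod_hom R M M"
    and "\<And>x. x \<in> carrier M \<Longrightarrow> p x \<in> P" and "\<And>x. x \<in> P \<Longrightarrow> p x = x"
proof -
  from assms obtain P' where P: "submodule P R M" "submodule P' R M" "P \<inter> P' = {\<zero>\<^bsub>M\<^esub>}"
    and sum: "P <+>\<^bsub>M\<^esub> P' = carrier M"
    by (auto simp: direct_summand_def)
  from direct_sum_projection[OF P, unfolded sum] show thesis
    using that by simp metis
qed

text \<open>The kernel \<open>K\<close> of \<open>p\<close> is a complement. An element of
  \<open>P\<close> killed by \<open>p\<close> equals its own image, hence is zero, and every x
  splits as p x + (x - p x).\<close>

lemma (in module) direct_summand_of_retraction:
  assumes P: "submodule P R M" and p: "p \<in> mod_hom R M M"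
    and range: "\<And>x. x \<in> carrier M \<Longrightarrow> p x \<in> P" and id: "\<And>x. x \<in> P \<Longrightarrow> p x = x"
  shows "direct_summand R M P"
proof -
  note P' = submoduleE[OF P] and hom = mod_homD[OF p]
  define K where "K = {x \<in> carrier M. p x = \<zero>\<^bsub>M\<^esub>}"
  have zero: "p \<zero>\<^bsub>M\<^esub> = \<zero>\<^bsub>M\<^esub>"
    using id submodule_zero[OF P] .
  have neg: "p (\<ominus>\<^bsub>M\<^esub> x) = \<ominus>\<^bsub>M\<^esub> p x" if "x \<in> carrier M" for x
    using hom(2)[of "\<ominus>\<^bsub>M\<^esub> x" x] hom(1)[of x] hom(1)[of "\<ominus>\<^bsub>M\<^esub> x"] that zero
    by (simp add: M.l_neg M.minus_equality)
  have "submodule K R M"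
    by (rule submoduleI) (auto simp: K_def zero neg hom)
  moreover have "P \<inter> K = {\<zero>\<^bsub>M\<^esub>}"
    using id zero submodule_zero[OF P] by (auto simp: K_def)
  moreover have "P <+>\<^bsub>M\<^esub> K = carrier M"
  proof
    show "P <+>\<^bsub>M\<^esub> K \<subseteq> carrier M"
      using P'(1) by (auto simp: mem_set_add_iff K_def subset_iff)
    show "carrier M \<subseteq> P <+>\<^bsub>M\<^esub> K"
    proof
      fix x assume x: "x \<in> carrier M"
      have px: "p x \<in> carrier M" using hom(1)[OF x] .
      \<comment> \<open>Since p x lies in \<open>P\<close>, it is fixed by \<open>p\<close>, so the
        two terms cancel.\<close>
      have "p (\<ominus>\<^bsub>M\<^esub> p x \<oplus>\<^bsub>M\<^esub> x) = \<zero>\<^bsub>M\<^esub>"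
        using x px by (simp add: hom(2) neg id[OF range[OF x]] M.l_neg)
      then have "\<ominus>\<^bsub>M\<^esub> p x \<oplus>\<^bsub>M\<^esub> x \<in> K"
        using x px by (simp add: K_def)
      moreover have "x = p x \<oplus>\<^bsub>M\<^esub> (\<ominus>\<^bsub>M\<^esub> p x \<oplus>\<^bsub>M\<^esub> x)"
        using x px by (simp add: M.r_neg2)
      ultimately show "x \<in> P <+>\<^bsub>M\<^esub> K"
        unfolding mem_set_add_iff using range[OF x] by blast
    qed
  qed
  ultimately show ?thesis
    using P by (auto simp: direct_summand_def)
qed

section \<open>Semi-reduced submodules\<close>

text \<open>Reducedness refers only to \<open>K\<close> with its inherited operations, so the
  ambient module matters only for \<open>K\<close> being a submodule.\<close>

lemma (in module) reduced_submodule_of_submodule: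
  assumes "submodule H R M"
  shows "reduced_submodule R (M\<lparr>carrier := H\<rparr>) K \<longleftrightarrow> reduced_submodule R M K \<and> K \<subseteq> H"
  using submodule_of_submodule[OF assms] by (auto simp: reduced_submodule_def)

text \<open>This expresses semi-reducedness inside \<open>M\<close>, without the restricted record:
  the reduced submodules of \<open>H\<close> are those of \<open>M\<close> contained in
  \<open>H\<close>, and finite sums in \<open>H\<close> and in \<open>M\<close> agree.\<close>

lemma (in module) semi_reduced_submodule_iff:
  "semi_reduced_submodule R M H \<longleftrightarrow> submodule H R M \<and>
    (\<forall>x\<in>H. \<exists>F f. finite F \<and> (\<forall>K\<in>F. reduced_submodule R M K \<and> K \<subseteq> H \<and> f K \<in> K) \<and>
       x = finsum M f F)"
  (is "_ \<longleftrightarrow> _ \<and> (\<forall>x\<in>H. ?S x)")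
proof (cases "submodule H R M")
  case True
  have S: "x \<in> Red R (M\<lparr>carrier := H\<rparr>) \<longleftrightarrow> ?S x" for x
  proof -
    have "x \<in> Red R (M\<lparr>carrier := H\<rparr>) \<longleftrightarrow>
        (\<exists>F f. finite F \<and> (\<forall>K\<in>F. reduced_submodule R M K \<and> K \<subseteq> H \<and> f K \<in> K) \<and>
           x = finsum (M\<lparr>carrier := H\<rparr>) f F)"
      unfolding Red_def submodule_sum_def reduced_submodule_of_submodule[OF True]
        mem_Collect_eq
      by (intro ex_cong1) blast
    also have "\<dots> \<longleftrightarrow> ?S x"
    proof (intro ex_cong1 conj_cong refl)
      fix F f
      assume "finite F" "\<forall>K\<in>F. reduced_submodule R M K \<and> K \<subseteq> H \<and> f K \<in> K"
      then have "finsum (M\<lparr>carrier := H\<rparr>) f F = finsum M f F"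
        using True by (intro finsum_submodule) auto
      then show "x = finsum (M\<lparr>carrier := H\<rparr>) f F \<longleftrightarrow> x = finsum M f F"
        by simp
    qed
    finally show ?thesis .
  qed
  \<comment> \<open>A submodule contains all finite sums of its elements, so \<open>Red\<close> of
    \<open>H\<close> is always contained in \<open>H\<close> and only the converse inclusion is a
    condition.\<close>
  have "x \<in> H" if Sx: "?S x" for x
  proof -
    from Sx obtain F f where F: "finite F" "x = finsum M f F"
      and mem: "\<forall>K\<in>F. reduced_submodule R M K \<and> K \<subseteq> H \<and> f K \<in> K"
      by blast
    from mem have "f \<in> F \<rightarrow> H" by blast
    then show ?thesis
      using finsum_in_submodule[OF True] F by simp
  qed
  then have "Red R (M\<lparr>carrier := H\<rparr>) \<subseteq> H"
    using S by blast
  then have "Red R (M\<lparr>carrier := H\<rparr>) = H \<longleftrightarrow> (\<forall>x\<in>H. ?S x)"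
    unfolding set_eq_iff subset_iff S by blast
  then show ?thesis
    using True by (simp add: semi_reduced_submodule_def semi_reduced_module_def)
qed (simp add: semi_reduced_submodule_def)

text \<open>Representations of the two components are merged into one. Summands are indexed by the
  reduced submodules themselves, so a submodule occurring in both families must receive the sum of
  its two elements, which it still contains.\<close>

lemma (in module) semi_reduced_submodule_set_add:
  assumes P: "semi_reduced_submodule R M P" and Q: "semi_reduced_submodule R M Q"
  shows "semi_reduced_submodule R M (P <+>\<^bsub>M\<^esub> Q)"
proof -
  have sub: "submodule P R M" "submodule Q R M"
    using P Q by (auto simp: semi_reduced_submodule_def)
  note incl = subset_set_add[OF sub]
  show ?thesis
    unfolding semi_reduced_submodule_iff
  proof (intro conjI ballI)
    show "submodule (P <+>\<^bsub>M\<^esub> Q) R M"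
      by (rule submodule_set_add[OF sub])
    fix x assume "x \<in> P <+>\<^bsub>M\<^esub> Q"
    then obtain a b where ab: "a \<in> P" "b \<in> Q" "x = a \<oplus>\<^bsub>M\<^esub> b"
      by (auto simp: mem_set_add_iff)
    from P ab(1) obtain F f where F: "finite F" "a = finsum M f F"
      and f: "\<forall>K\<in>F. reduced_submodule R M K \<and> K \<subseteq> P \<and> f K \<in> K"
      unfolding semi_reduced_submodule_iff by blast
    from Q ab(2) obtain G g where G: "finite G" "b = finsum M g G"
      and g: "\<forall>K\<in>G. reduced_submodule R M K \<and> K \<subseteq> Q \<and> g K \<in> K"
      unfolding semi_reduced_submodule_iff by blast
    \<comment> \<open>Both families are extended to the common index set
      \<open>F \<union> G\<close>. Zero is a legitimate value there because it lies in every
      submodule.\<close>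
    define f' where "f' K = (if K \<in> F then f K else \<zero>\<^bsub>M\<^esub>)" for K
    define g' where "g' K = (if K \<in> G then g K else \<zero>\<^bsub>M\<^esub>)" for K
    have red: "reduced_submodule R M K" if "K \<in> F \<union> G" for K
      using that f g by blast
    then have subm: "submodule K R M" if "K \<in> F \<union> G" for K
      using that by (auto simp: reduced_submodule_def)
    have mem: "f' K \<in> K" "g' K \<in> K" if "K \<in> F \<union> G" for K
      using submodule_zero[OF subm[OF that]] f g by (auto simp: f'_def g'_def)
    have car: "f' \<in> F \<union> G \<rightarrow> carrier M" "g' \<in> F \<union> G \<rightarrow> carrier M"
      using mem submoduleE(1)[OF subm] by blast+
    \<comment> \<open>The added indices contribute only zeros.\<close>
    have "finsum M f' (F \<union> G) = finsum M f F"
      using F(1) G(1) car(1)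
      by (intro M.add.finprod_mono_neutral_cong_right) (auto simp: f'_def)
    moreover have "finsum M g' (F \<union> G) = finsum M g G"
      using F(1) G(1) car(2)
      by (intro M.add.finprod_mono_neutral_cong_right) (auto simp: g'_def)
    ultimately have "x = (\<Oplus>\<^bsub>M\<^esub>K\<in>F \<union> G. f' K \<oplus>\<^bsub>M\<^esub> g' K)"
      using ab(3) F(2) G(2) M.finsum_addf[OF car] by simp
    moreover have "f' K \<oplus>\<^bsub>M\<^esub> g' K \<in> K" if "K \<in> F \<union> G" for K
      using submoduleE(5)[OF subm[OF that]] mem[OF that] by blast
    moreover have "K \<subseteq> P <+>\<^bsub>M\<^esub> Q" if "K \<in> F \<union> G" for K
      using that f g incl by blast
    ultimately show "\<exists>F f. finite F \<and>
        (\<forall>K\<in>F. reduced_submodule R M K \<and> K \<subseteq> P <+>\<^bsub>M\<^esub> Q \<and> f K \<in> K) \<and> x = finsum M f F"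
      using red F(1) G(1)
      by (intro exI[of _ "F \<union> G"] exI[of _ "\<lambda>K. f' K \<oplus>\<^bsub>M\<^esub> g' K"]) simp
  qed
qed

section \<open>Red-quasi-injective modules\<close>

lemma Red_quasi_injectiveE:
  assumes "Red_quasi_injective R M" and "semi_reduced_submodule R M K"
    and "f \<in> mod_hom R (M\<lparr>carrier := K\<rparr>) M"
  obtains g where "g \<in> mod_hom R M M" and "\<And>x. x \<in> K \<Longrightarrow> g x = f x"
  using assms unfolding Red_quasi_injective_def Red_injective_def by blast

text \<open>Let \<open>g\<close> extend the inverse of the isomorphism \<open>f\<close>, and let
  \<open>p\<close> be a retraction onto \<open>P\<close>. Then f o p o g is a retraction onto
  \<open>Q\<close>: on \<open>Q\<close>, \<open>g\<close> gives the preimage in \<open>P\<close>,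
  \<open>p\<close> fixes it and \<open>f\<close> sends it back.\<close>

lemma (in module) Red_C2:
  assumes inj: "Red_quasi_injective R M"
    and P: "semi_reduced_submodule R M P" and Q: "semi_reduced_submodule R M Q"
    and iso: "mod_isomorphic R (M\<lparr>carrier := P\<rparr>) (M\<lparr>carrier := Q\<rparr>)"
    and "direct_summand R M P"
  shows "direct_summand R M Q"
proof -
  have subP: "submodule P R M" and subQ: "submodule Q R M"
    using P Q by (auto simp: semi_reduced_submodule_def)
  note P' = submoduleE[OF subP] and Q' = submoduleE[OF subQ]
  from iso obtain f where "f \<in> mod_hom R (M\<lparr>carrier := P\<rparr>) (M\<lparr>carrier := Q\<rparr>)"
    and bij: "bij_betw f P Q"
    by (auto simp: mod_isomorphic_def)
  note f = mod_homD[OF this(1), simplified]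
  define h where "h = inv_into P f"
  have h: "h y \<in> P" "f (h y) = y" if "y \<in> Q" for y
    using bij that by (auto simp: h_def bij_betw_def inv_into_into f_inv_into_f)
  have hf: "h (f x) = x" if "x \<in> P" for x
    using bij that by (simp add: h_def bij_betw_def)
  have "h \<in> mod_hom R (M\<lparr>carrier := Q\<rparr>) M"
  proof (rule mod_homI; simp)
    show "h x \<in> carrier M" if "x \<in> Q" for x
      using h(1)[OF that] P'(1) by blast
    \<comment> \<open>Linearity of the inverse: \<open>f\<close> maps h x + h y to x + y, and
      applying \<open>h\<close> recovers the former. Scalars are handled in the same way.\<close>
    show "h (x \<oplus>\<^bsub>M\<^esub> y) = h x \<oplus>\<^bsub>M\<^esub> h y" if "x \<in> Q" "y \<in> Q" for x y
      using hf[of "h x \<oplus>\<^bsub>M\<^esub> h y"] that h P'(5) by (simp add: f(2))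
    show "h (r \<odot>\<^bsub>M\<^esub> x) = r \<odot>\<^bsub>M\<^esub> h x" if "r \<in> carrier R" "x \<in> Q" for r x
      using hf[of "r \<odot>\<^bsub>M\<^esub> h x"] that h P'(4) by (simp add: f(3))
  qed
  from Red_quasi_injectiveE[OF inj Q this]
  obtain g where "g \<in> mod_hom R M M" and gh: "\<And>x. x \<in> Q \<Longrightarrow> g x = h x" by metis
  note g = mod_homD[OF this(1)]
  from direct_summand_retraction[OF assms(5)] obtain p where "p \<in> mod_hom R M M"
    and p_in: "\<And>x. x \<in> carrier M \<Longrightarrow> p x \<in> P" and p_id: "\<And>x. x \<in> P \<Longrightarrow> p x = x" by metis
  note p = mod_homD[OF this(1)]
  show ?thesis
  proof (rule direct_summand_of_retraction[OF subQ])
    \<comment> \<open>The map \<open>p\<close> is inserted because \<open>g\<close> may leave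
      \<open>P\<close> outside \<open>Q\<close>, while \<open>f\<close> is known to be linear only
      on \<open>P\<close>.\<close>
    show "(\<lambda>x. f (p (g x))) \<in> mod_hom R M M"
      using Q'(1) f(1) by (intro mod_homI) (auto simp: f(2,3) g p p_in)
    show "f (p (g x)) \<in> Q" if "x \<in> carrier M" for x
      using f(1) p_in g(1) that by blast
    show "f (p (g x)) = x" if "x \<in> Q" for x
      using that by (simp add: gh h p_id)
  qed
qed

text \<open>A projection of \<open>M\<close> onto \<open>P\<close> along an arbitrary complement
  need not vanish on \<open>Q\<close>. Extending the projection of \<open>P <+> Q\<close> along
  \<open>Q\<close> enforces this, and it is what allows two such maps to be added in the proof of
  Red-C3.\<close>

lemma (in module) Red_quasi_injective_extend_projection:
  assumes inj: "Red_quasi_injective R M"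
    and P: "semi_reduced_submodule R M P" and Q: "semi_reduced_submodule R M Q"
    and PQ: "P \<inter> Q = {\<zero>\<^bsub>M\<^esub>}" and "direct_summand R M P"
  obtains e where "e \<in> mod_hom R M M" and "\<And>x. x \<in> carrier M \<Longrightarrow> e x \<in> P"
    and "\<And>x. x \<in> P \<Longrightarrow> e x = x" and "\<And>x. x \<in> Q \<Longrightarrow> e x = \<zero>\<^bsub>M\<^esub>"
proof -
  have sub: "submodule P R M" "submodule Q R M"
    using P Q by (auto simp: semi_reduced_submodule_def)
  note incl = subset_set_add[OF sub]
  from direct_sum_projection[OF sub PQ] obtain q
    where q: "q \<in> mod_hom R (M\<lparr>carrier := P <+>\<^bsub>M\<^esub> Q\<rparr>) M"
      and q_id: "\<And>a. a \<in> P \<Longrightarrow> q a = a" and q_zero: "\<And>b. b \<in> Q \<Longrightarrow> q b = \<zero>\<^bsub>M\<^esub>"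
    by metis
  from Red_quasi_injectiveE[OF inj semi_reduced_submodule_set_add[OF P Q] q]
  obtain g where "g \<in> mod_hom R M M" and gq: "\<And>x. x \<in> P <+>\<^bsub>M\<^esub> Q \<Longrightarrow> g x = q x" by metis
  note g = mod_homD[OF this(1)]
  \<comment> \<open>The extension \<open>g\<close> may take values outside \<open>P\<close>;
    composing with \<open>p\<close> forces them into \<open>P\<close> and changes nothing on
    \<open>P <+> Q\<close>, where \<open>g\<close> already takes values in \<open>P\<close>.\<close>
  from direct_summand_retraction[OF assms(5)] obtain p where "p \<in> mod_hom R M M"
    and p_in: "\<And>x. x \<in> carrier M \<Longrightarrow> p x \<in> P" and p_id: "\<And>x. x \<in> P \<Longrightarrow> p x = x" by metis
  note p = mod_homD[OF this(1)]
  show thesis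
  proof
    show "(\<lambda>x. p (g x)) \<in> mod_hom R M M"
      by (intro mod_homI) (auto simp: g p)
    show "p (g x) \<in> P" if "x \<in> carrier M" for x
      using p_in g(1) that by blast
    show "p (g x) = x" if "x \<in> P" for x
      using that incl(1) by (simp add: gq q_id p_id subset_iff)
    show "p (g x) = \<zero>\<^bsub>M\<^esub>" if "x \<in> Q" for x
      using that incl(2) by (simp add: gq q_zero p_id submodule_zero[OF sub(1)] subset_iff)
  qed
qed

text \<open>Let \<open>d\<close> retract \<open>M\<close> onto \<open>P\<close> and kill
  \<open>Q\<close>, and let \<open>e\<close> do the same with the roles exchanged. On a + b with a
  in \<open>P\<close> and b in \<open>Q\<close>, \<open>d\<close> returns a and \<open>e\<close>
  returns b, so d + e is a retraction onto \<open>P <+> Q\<close>.\<close>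

lemma (in module) Red_C3:
  assumes inj: "Red_quasi_injective R M"
    and P: "semi_reduced_submodule R M P" and Q: "semi_reduced_submodule R M Q"
    and PQ: "P \<inter> Q = {\<zero>\<^bsub>M\<^esub>}" and "direct_summand R M P" "direct_summand R M Q"
  shows "direct_summand R M (P <+>\<^bsub>M\<^esub> Q)"
proof -
  have sub: "submodule P R M" "submodule Q R M"
    using P Q by (auto simp: semi_reduced_submodule_def)
  note car = submoduleE(1)[OF sub(1)] submoduleE(1)[OF sub(2)]
  from Red_quasi_injective_extend_projection[OF inj P Q PQ assms(5)] obtain d
    where "d \<in> mod_hom R M M" and d_in: "\<And>x. x \<in> carrier M \<Longrightarrow> d x \<in> P"
    and d_id: "\<And>x. x \<in> P \<Longrightarrow> d x = x" and d_zero: "\<And>x. x \<in> Q \<Longrightarrow> d x = \<zero>\<^bsub>M\<^esub>" by metis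
  note d = mod_homD[OF this(1)]
  have "Q \<inter> P = {\<zero>\<^bsub>M\<^esub>}"
    using PQ by blast
  from Red_quasi_injective_extend_projection[OF inj Q P this assms(6)] obtain e
    where "e \<in> mod_hom R M M" and e_in: "\<And>x. x \<in> carrier M \<Longrightarrow> e x \<in> Q"
    and e_id: "\<And>x. x \<in> Q \<Longrightarrow> e x = x" and e_zero: "\<And>x. x \<in> P \<Longrightarrow> e x = \<zero>\<^bsub>M\<^esub>" by metis
  note e = mod_homD[OF this(1)]
  show ?thesis
  proof (rule direct_summand_of_retraction[OF submodule_set_add[OF sub]])
    show "(\<lambda>x. d x \<oplus>\<^bsub>M\<^esub> e x) \<in> mod_hom R M M"
      by (intro mod_homI) (auto simp: d e smult_r_distr M.a_ac)
    show "d x \<oplus>\<^bsub>M\<^esub> e x \<in> P <+>\<^bsub>M\<^esub> Q" if "x \<in> carrier M" for x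
      using d_in e_in that by (auto simp: mem_set_add_iff)
    show "d x \<oplus>\<^bsub>M\<^esub> e x = x" if "x \<in> P <+>\<^bsub>M\<^esub> Q" for x
      using that car by (auto simp: mem_set_add_iff d(2) e(2) d_id d_zero e_id e_zero subset_iff)
  qed
qed

text \<open>The direct sum in the second part is the internal sum \<open>P <+> Q\<close>; the
  condition on the intersection makes it direct.\<close>

theorem proposition10:
  fixes R :: "('a, 'r) ring_scheme" and N :: "('a, 'b, 'n) module_scheme"
  assumes "module R N"
    and "Red_quasi_injective R N"
  shows "(\<forall>P Q. semi_reduced_submodule R N P \<longrightarrow> semi_reduced_submodule R N Q \<longrightarrow>
            mod_isomorphic R (N\<lparr>carrier := P\<rparr>) (N\<lparr>carrier := Q\<rparr>) \<longrightarrow>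
            direct_summand R N P \<longrightarrow> direct_summand R N Q)
       \<and> (\<forall>P Q. semi_reduced_submodule R N P \<longrightarrow> semi_reduced_submodule R N Q \<longrightarrow>
            P \<inter> Q = {\<zero>\<^bsub>N\<^esub>} \<longrightarrow>
            direct_summand R N P \<longrightarrow> direct_summand R N Q \<longrightarrow>
            direct_summand R N (P <+>\<^bsub>N\<^esub> Q))"
  using module.Red_C2[OF assms] module.Red_C3[OF assms] by blast

end
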